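(* Let $k$ be a non-archimedean local field with valuation ring $\mathcal{O}$ and maximal ideal $\mathfrak{p}=\pi\mathcal{O}$, and let $R=\{\mathrm{diag}(d_1,\dots,d_n):d_i\in\mathcal{O}\}$. Every $\mathcal{O}$-order $S\subset M_n(k)$ containing $R$ has the form $S=(\mathfrak{p}^{\nu_{ij}}):=\{A=(a_{ij}): a_{ij}\in\mathfrak{p}^{\nu_{ij}}\}$ for a unique integer matrix $\boldsymbol{\nu}=(\nu_{ij})$ with $\nu_{ii}=0$. The maps $$S=(\mathfrak{p}^{\nu_{ij}})\ \longmapsto\ C(\boldsymbol{\nu}),\qquad C(\boldsymbol{\nu})\ \longmapsto\ \bigcap_{m\in C(\boldsymbol{\nu})\cap(\{0\}\times\mathbb{Z}^{n-1})}\Lambda(m)$$ are mutually inverse bijections between the set of orders in $M_n(k)$ containing $R$ and the set of reduced convex polytopes $C(\boldsymbol{\nu})$.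
   Context: For $\boldsymbol{\nu}=(\nu_{ij})\in M_n(\mathbb{Z})$, $C(\boldsymbol{\nu})$ is the set of $x=(x_1,\dots,x_n)\in\mathbb{R}^n$ with $x_1=0$ and $-\nu_{ji}\le x_i-x_j\le\nu_{ij}$ for all $i,j$; it is called reduced if it contains at least one point of $\{0\}\times\mathbb{Z}^{n-1}$ and every hyperplane $x_i-x_j=\nu_{ij}$ meets it. For $m=(0,m_2,\dots,m_n)\in\{0\}\times\mathbb{Z}^{n-1}$, $\Lambda(m)=\{A=(a_{ij})\in M_n(k): a_{ij}\in\mathfrak{p}^{m_i-m_j}\}$ (with $m_1=0$); these are the maximal orders containing $R$, i.e. the vertices of the apartment of the affine building of $SL_n(k)$ attached to the standard basis $e_1,\dots,e_n$ of $k^n$ (vertex $m$ = homothety class of $\bigoplus_i\mathcal{O}\pi^{m_i}e_i$). An order is a subring containing $1$ which is a free $\mathcal{O}$-module of rank $n^2$. *)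

theory Defs
  imports "HOL-Analysis.Analysis" "HOL-Algebra.Subrings"
begin

definition val_ring :: "('k::field \<Rightarrow> int) \<Rightarrow> 'k set" where
  "val_ring v = {x. x = 0 \<or> 0 \<le> v x}"

definition max_ideal :: "('k::field \<Rightarrow> int) \<Rightarrow> 'k set" where
  "max_ideal v = {x. x = 0 \<or> 0 < v x}"

text \<open>
  A non-archimedean local field is a field that is complete for a normalised discrete valuation
  with finite residue field (of either characteristic).  The value \<open>v 0\<close> (mathematically
  infinity) is left unspecified; nothing below depends on it.
\<close>

locale nonarch_local_field =
  fixes v :: "'k::field \<Rightarrow> int"
  assumes v_mult: "x \<noteq> 0 \<Longrightarrow> y \<noteq> 0 \<Longrightarrow> v (x * y) = v x + v y"
    and v_add: "x \<noteq> 0 \<Longrightarrow> y \<noteq> 0 \<Longrightarrow> x + y \<noteq> 0 \<Longrightarrow> min (v x) (v y) \<le> v (x + y)"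
    and v_surj: "v ` {x. x \<noteq> 0} = UNIV"
    and finite_residue_field:
      "finite (val_ring v // {(x, y). x \<in> val_ring v \<and> y \<in> val_ring v \<and> x - y \<in> max_ideal v})"
    and complete:
      "\<And>X :: nat \<Rightarrow> 'k.
         (\<And>N. \<exists>M. \<forall>p\<ge>M. \<forall>q\<ge>M. X p = X q \<or> N \<le> v (X p - X q)) \<Longrightarrow>
         \<exists>L. \<forall>N. \<exists>M. \<forall>p\<ge>M. X p = L \<or> N \<le> v (X p - L)"

text \<open>The fractional ideal \<open>\<pi>\<^sup>m \<O>\<close>; it is only used when \<open>\<pi>\<close> generates the maximal ideal.\<close>

definition frac_ideal :: "('k::field \<Rightarrow> int) \<Rightarrow> 'k \<Rightarrow> int \<Rightarrow> 'k set" where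
  "frac_ideal v \<pi> m = (\<lambda>a. \<pi> powi m * a) ` val_ring v"

text \<open>
  The ring of matrices indexed by the finite type \<open>'n\<close>.  The type class multiplication on
  \<open>'k ^ 'n ^ 'n\<close> is componentwise and is not the one meant here.
\<close>

definition matrix_ring :: "('k::field ^ 'n ^ 'n) ring" where
  "matrix_ring = \<lparr>carrier = UNIV, mult = (**), one = mat 1, zero = 0, add = (+)\<rparr>"

definition smult_matrix :: "'k::field \<Rightarrow> 'k ^ 'n ^ 'n \<Rightarrow> 'k ^ 'n ^ 'n" where
  "smult_matrix c A = (\<chi> i j. c * A $ i $ j)"

definition free_module_of_rank ::
  "'k::field set \<Rightarrow> nat \<Rightarrow> ('k ^ 'n ^ 'n) set \<Rightarrow> bool" where
  "free_module_of_rank \<O> r M \<longleftrightarrow>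
     (\<exists>B. finite B \<and> card B = r \<and>
        M = {\<Sum>b\<in>B. smult_matrix (c b) b | c. \<forall>b\<in>B. c b \<in> \<O>} \<and>
        (\<forall>c. (\<forall>b\<in>B. c b \<in> \<O>) \<and> (\<Sum>b\<in>B. smult_matrix (c b) b) = 0 \<longrightarrow> (\<forall>b\<in>B. c b = 0)))"

definition is_order :: "('k::field \<Rightarrow> int) \<Rightarrow> ('k ^ 'n ^ 'n) set \<Rightarrow> bool" where
  "is_order v S \<longleftrightarrow>
     subring S matrix_ring \<and> free_module_of_rank (val_ring v) (CARD('n)^2) S"

definition diag_order :: "('k::field \<Rightarrow> int) \<Rightarrow> ('k ^ 'n ^ 'n) set" where
  "diag_order v = {(\<chi> i j. if i = j then d i else 0) | d. \<forall>i. d i \<in> val_ring v}"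

definition orders_containing_diag :: "('k::field \<Rightarrow> int) \<Rightarrow> ('k ^ 'n ^ 'n) set set" where
  "orders_containing_diag v = {S. is_order v S \<and> diag_order v \<subseteq> S}"

definition ideal_matrices ::
  "('k::field \<Rightarrow> int) \<Rightarrow> 'k \<Rightarrow> int ^ 'n ^ 'n \<Rightarrow> ('k ^ 'n ^ 'n) set" where
  "ideal_matrices v \<pi> \<nu> = {A. \<forall>i j. A $ i $ j \<in> frac_ideal v \<pi> (\<nu> $ i $ j)}"

definition maximal_order ::
  "('k::field \<Rightarrow> int) \<Rightarrow> 'k \<Rightarrow> int ^ 'n \<Rightarrow> ('k ^ 'n ^ 'n) set" where
  "maximal_order v \<pi> m = {A. \<forall>i j. A $ i $ j \<in> frac_ideal v \<pi> (m $ i - m $ j)}"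

text \<open>In the following, \<open>o1\<close> is the distinguished (``first'') index, whose coordinate is zero.\<close>

definition poly_C :: "'n::finite \<Rightarrow> int ^ 'n ^ 'n \<Rightarrow> (real ^ 'n) set" where
  "poly_C o1 \<nu> =
     {x. x $ o1 = 0 \<and>
         (\<forall>i j. - real_of_int (\<nu> $ j $ i) \<le> x $ i - x $ j \<and> x $ i - x $ j \<le> real_of_int (\<nu> $ i $ j))}"

definition lattice_points :: "'n::finite \<Rightarrow> (real ^ 'n) set \<Rightarrow> (int ^ 'n) set" where
  "lattice_points o1 C = {m. m $ o1 = 0 \<and> (\<chi> i. real_of_int (m $ i)) \<in> C}"

text \<open>
  Being reduced is a property of \<open>\<nu>\<close>; the polytopes form a set of subsets of \<open>\<real>\<^sup>n\<close>, so that
  matrices defining the same polytope are identified.  The case \<open>i = j\<close> of the second condition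
  says that the diagonal of \<open>\<nu>\<close> is zero.  This does not exclude any polytope, as \<open>poly_C o1 \<nu>\<close> does
  not change when a nonnegative diagonal is replaced by zero.
\<close>

definition reduced :: "'n::finite \<Rightarrow> int ^ 'n ^ 'n \<Rightarrow> bool" where
  "reduced o1 \<nu> \<longleftrightarrow>
     lattice_points o1 (poly_C o1 \<nu>) \<noteq> {} \<and>
     (\<forall>i j. {x. x $ i - x $ j = real_of_int (\<nu> $ i $ j)} \<inter> poly_C o1 \<nu> \<noteq> {})"

definition reduced_polytopes :: "'n::finite \<Rightarrow> (real ^ 'n) set set" where
  "reduced_polytopes o1 = {poly_C o1 \<nu> | \<nu>. reduced o1 \<nu>}"

definition exponent_matrix ::
  "('k::field \<Rightarrow> int) \<Rightarrow> 'k \<Rightarrow> ('k ^ 'n ^ 'n) set \<Rightarrow> int ^ 'n ^ 'n" where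
  "exponent_matrix v \<pi> S = (THE \<nu>. (\<forall>i. \<nu> $ i $ i = 0) \<and> S = ideal_matrices v \<pi> \<nu>)"

definition polytope_of_order ::
  "('k::field \<Rightarrow> int) \<Rightarrow> 'k \<Rightarrow> 'n::finite \<Rightarrow> ('k ^ 'n ^ 'n) set \<Rightarrow> (real ^ 'n) set" where
  "polytope_of_order v \<pi> o1 S = poly_C o1 (exponent_matrix v \<pi> S)"

definition order_of_polytope ::
  "('k::field \<Rightarrow> int) \<Rightarrow> 'k \<Rightarrow> 'n::finite \<Rightarrow> (real ^ 'n) set \<Rightarrow> ('k ^ 'n ^ 'n) set" where
  "order_of_polytope v \<pi> o1 C = (\<Inter>m\<in>lattice_points o1 C. maximal_order v \<pi> m)"

end

theory Submission
  imports Defs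
begin

text \<open>
  An order containing the diagonal idempotents is the direct sum of its entry modules, and each of
  these is a nonzero bounded \<open>\<O>\<close>-submodule of \<open>k\<close>, hence a power of \<open>\<pp>\<close>.  The exponents satisfy
  \<open>\<nu>\<^sub>i\<^sub>i = 0\<close> and the triangle inequality \<open>\<nu>\<^sub>i\<^sub>k \<le> \<nu>\<^sub>i\<^sub>j + \<nu>\<^sub>j\<^sub>k\<close>; these are exactly the reduced matrices,
  because under the triangle inequality the point \<open>x\<^sub>i = \<nu>\<^sub>i\<^sub>j - \<nu>\<^sub>1\<^sub>j\<close> is a lattice point of
  \<open>C(\<nu>)\<close> with \<open>x\<^sub>i - x\<^sub>j = \<nu>\<^sub>i\<^sub>j\<close>.  For the same reason the orders \<open>\<Lambda>(m)\<close> with \<open>m \<in> C(\<nu>)\<close> intersect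
  in \<open>(\<pp>\<^sup>\<nu>)\<close>.
\<close>

section \<open>Elementary matrices\<close>

definition elem_matrix :: "'n \<Rightarrow> 'n \<Rightarrow> 'k \<Rightarrow> 'k::field ^ 'n ^ 'n" where
  "elem_matrix i j c = (\<chi> a b. if a = i \<and> b = j then c else 0)"

lemma elem_matrix_nth [simp]:
  "elem_matrix i j c $ a $ b = (if a = i \<and> b = j then c else 0)"
  by (simp add: elem_matrix_def)

lemma smult_matrix_nth [simp]: "smult_matrix c A $ i $ j = c * A $ i $ j"
  by (simp add: smult_matrix_def)

lemma sum_matrix_nth [simp]:
  "(\<Sum>b\<in>B. f b :: 'k::field ^ 'n ^ 'm) $ i $ j = (\<Sum>b\<in>B. f b $ i $ j)"
  by simp

lemma elem_matrix_mult_right_nth: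
  fixes A :: "'k::field ^ 'n::finite ^ 'n"
  shows "(A ** elem_matrix j j c) $ a $ b = (if b = j then A $ a $ j * c else 0)"
proof -
  have "(A ** elem_matrix j j c) $ a $ b =
      (\<Sum>k\<in>UNIV. if k = j then (if b = j then A $ a $ j * c else 0) else 0)"
    unfolding matrix_matrix_mult_def vec_lambda_beta by (rule sum.cong) auto
  then show ?thesis by simp
qed

lemma elem_matrix_mult_left_nth:
  fixes A :: "'k::field ^ 'n::finite ^ 'n"
  shows "(elem_matrix i j c ** A) $ a $ b = (if a = i then c * A $ j $ b else 0)"
proof -
  have "(elem_matrix i j c ** A) $ a $ b =
      (\<Sum>k\<in>UNIV. if k = j then (if a = i then c * A $ j $ b else 0) else 0)"
    unfolding matrix_matrix_mult_def vec_lambda_beta by (rule sum.cong) auto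
  then show ?thesis by simp
qed

lemma elem_matrix_mult_elem_matrix:
  fixes c d :: "'k::field" and i j k :: "'n::finite"
  shows "elem_matrix i j c ** elem_matrix j k d = elem_matrix i k (c * d)"
  by (simp add: vec_eq_iff elem_matrix_mult_left_nth)

text \<open>For \<open>c\<close> in \<O> both outer factors lie in the diagonal order, so an order
  containing it also contains each entry of \<open>A\<close> as a matrix of its own. The factor
  \<open>c\<close> makes the same identity show that the entries at a given place are stable under
  \<O>.\<close>

lemma elem_matrix_sandwich:
  fixes A :: "'k::field ^ 'n::finite ^ 'n"
  shows "elem_matrix i i c ** A ** elem_matrix j j 1 = elem_matrix i j (c * A $ i $ j)"
  by (simp add: vec_eq_iff elem_matrix_mult_left_nth elem_matrix_mult_right_nth)

lemma matrix_eq_sum_elem: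
  fixes A :: "'k::field ^ 'n::finite ^ 'n"
  shows "A = (\<Sum>(i, j)\<in>UNIV. elem_matrix i j (A $ i $ j))"
proof -
  have "(\<Sum>p\<in>UNIV. elem_matrix (fst p) (snd p) (A $ fst p $ snd p)) $ a $ b = A $ a $ b" for a b
  proof -
    have "(\<Sum>p\<in>UNIV. elem_matrix (fst p) (snd p) (A $ fst p $ snd p)) $ a $ b =
        (\<Sum>p\<in>UNIV. if p = (a, b) then A $ a $ b else 0)"
      unfolding sum_matrix_nth by (rule sum.cong) auto
    then show ?thesis by simp
  qed
  then show ?thesis by (simp add: vec_eq_iff case_prod_beta)
qed

text \<open>The scaling \<open>d\<close> lets one family serve twice: \<open>d = 1\<close> gives the
  standard basis over the field, and entries with \<open>v (d i j) = \<nu> $ i $ j\<close> give an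
  \<O>-basis of the matrices with exponents \<nu>.\<close>

definition elem_basis :: "('n \<Rightarrow> 'n \<Rightarrow> 'k) \<Rightarrow> ('k::field ^ 'n ^ 'n) set" where
  "elem_basis d = range (\<lambda>(i, j). elem_matrix i j (d i j))"

lemma inj_elem_matrix:
  assumes "\<And>i j. d i j \<noteq> 0"
  shows "inj (\<lambda>(i, j). elem_matrix i j (d i j))"
proof (rule injI, clarify)
  fix i j i' j' assume "elem_matrix i j (d i j) = elem_matrix i' j' (d i' j')"
  then have "elem_matrix i j (d i j) $ i $ j = elem_matrix i' j' (d i' j') $ i $ j"
    by simp
  then show "i = i' \<and> j = j'" using assms by (simp split: if_splits)
qed

lemma finite_elem_basis [simp]: "finite (elem_basis (d :: 'n::finite \<Rightarrow> 'n \<Rightarrow> 'k::field))"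
  by (simp add: elem_basis_def)

lemma card_elem_basis:
  fixes d :: "'n::finite \<Rightarrow> 'n \<Rightarrow> 'k::field"
  assumes "\<And>i j. d i j \<noteq> 0"
  shows "card (elem_basis d) = CARD('n)^2"
  unfolding elem_basis_def card_image[OF inj_elem_matrix[of d, OF assms]]
  by (simp add: power2_eq_square)

text \<open>Only the basis matrix at place \<open>(i, j)\<close> contributes there. Coefficients can
  thus be read off entrywise, which yields both spanning and independence.\<close>

lemma sum_elem_basis_nth:
  fixes d :: "'n::finite \<Rightarrow> 'n \<Rightarrow> 'k::field"
  assumes "\<And>i j. d i j \<noteq> 0"
  shows "(\<Sum>b\<in>elem_basis d. smult_matrix (c b) b) $ i $ j = c (elem_matrix i j (d i j)) * d i j"
proof -
  have "(\<Sum>b\<in>elem_basis d. smult_matrix (c b) b) $ i $ j =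
      (\<Sum>p\<in>UNIV. if p = (i, j) then c (elem_matrix i j (d i j)) * d i j else 0)"
    unfolding elem_basis_def sum.reindex[OF inj_elem_matrix[of d, OF assms]] sum_matrix_nth
    by (rule sum.cong) (auto split: if_splits)
  then show ?thesis by simp
qed

section \<open>Matrices as a finite-dimensional vector space over the field\<close>

interpretation matrix_space: vector_space "smult_matrix :: 'k::field \<Rightarrow> 'k ^ 'n::finite ^ 'n \<Rightarrow> _"
  by unfold_locales (auto simp: vec_eq_iff algebra_simps)

interpretation matrix_space: finite_dimensional_vector_space
  "smult_matrix :: 'k::field \<Rightarrow> 'k ^ 'n::finite ^ 'n \<Rightarrow> _" "elem_basis (\<lambda>_ _. 1)"
proof unfold_locales
  let ?B = "elem_basis (\<lambda>_ _. 1) :: ('k ^ 'n ^ 'n) set"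
  show "finite ?B" by simp
  show "matrix_space.independent ?B"
  proof
    assume "matrix_space.dependent ?B"
    then obtain u b where b: "b \<in> ?B" "u b \<noteq> 0" and u: "(\<Sum>b\<in>?B. smult_matrix (u b) b) = 0"
      unfolding matrix_space.dependent_finite[OF finite_elem_basis] by blast
    obtain i j where "b = elem_matrix i j 1" using b by (auto simp: elem_basis_def)
    with arg_cong[OF u, of "\<lambda>A. A $ i $ j"] b show False
      using sum_elem_basis_nth[of "\<lambda>_ _. 1" u i j] by simp
  qed
  have "A \<in> matrix_space.span ?B" for A :: "'k ^ 'n ^ 'n"
  proof -
    have "elem_matrix i j (A $ i $ j) = smult_matrix (A $ i $ j) (elem_matrix i j 1)" for i j
      by (simp add: vec_eq_iff)
    then have "(\<Sum>(i, j)\<in>UNIV. elem_matrix i j (A $ i $ j)) =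
        (\<Sum>(i, j)\<in>UNIV. smult_matrix (A $ i $ j) (elem_matrix i j 1))"
      by simp
    also have "\<dots> \<in> matrix_space.span ?B"
      unfolding case_prod_beta elem_basis_def
      by (intro matrix_space.span_sum matrix_space.span_scale matrix_space.span_base) auto
    finally show ?thesis by (simp only: matrix_eq_sum_elem[symmetric])
  qed
  then show "matrix_space.span ?B = UNIV" by blast
qed

text \<open>As many independent matrices as the dimension span the whole space, so they cannot all
  lie in the proper subspace of matrices that vanish at \<open>(i, j)\<close>.\<close>

lemma matrix_space_independent_nth_nonzero:
  fixes B :: "('k::field ^ 'n::finite ^ 'n) set"
  assumes indep: "matrix_space.independent B" and card: "card B = CARD('n)^2"
  shows "\<exists>b\<in>B. b $ i $ j \<noteq> 0"
proof (rule ccontr)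
  assume "\<not> ?thesis"
  then have B: "B \<subseteq> {A. A $ i $ j = 0}" by blast
  have "matrix_space.subspace {A :: 'k ^ 'n ^ 'n. A $ i $ j = 0}"
    by (auto simp: matrix_space.subspace_def)
  with B have "matrix_space.span B \<subseteq> {A. A $ i $ j = 0}"
    by (rule matrix_space.span_minimal)
  moreover have "card B = matrix_space.dim (UNIV :: ('k ^ 'n ^ 'n) set)"
    using card card_elem_basis[of "\<lambda>(_ :: 'n) _. 1 :: 'k"] by (simp add: matrix_space.dim_UNIV)
  then have "UNIV \<subseteq> matrix_space.span B"
    using matrix_space.card_ge_dim_independent[OF subset_UNIV indep] by simp
  ultimately have "(elem_matrix i j 1 :: 'k ^ 'n ^ 'n) $ i $ j = 0" by blast
  then show False by simp
qed

section \<open>The matrix ring\<close>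

lemma ring_matrix_ring: "ring (matrix_ring :: ('k::field ^ 'n::finite ^ 'n) ring)"
proof (rule ringI)
  show "abelian_group (matrix_ring :: ('k ^ 'n ^ 'n) ring)"
    by (rule abelian_groupI)
      (auto simp: matrix_ring_def algebra_simps intro: exI[of _ "- _"] left_minus)
  show "monoid (matrix_ring :: ('k ^ 'n ^ 'n) ring)"
    by (rule monoidI) (auto simp: matrix_ring_def matrix_mul_assoc)
qed (auto simp: matrix_ring_def matrix_add_ldistrib matrix_matrix_mult_def vec_eq_iff
    algebra_simps sum.distrib)

lemma a_inv_matrix_ring:
  "\<ominus>\<^bsub>matrix_ring\<^esub> (A :: 'k::field ^ 'n::finite ^ 'n) = - A"
  using abelian_group.minus_equality[OF ring.is_abelian_group[OF ring_matrix_ring], of "- A" A]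
  by (simp add: matrix_ring_def)

lemma subring_matrix_ringD:
  fixes S :: "('k::field ^ 'n::finite ^ 'n) set"
  assumes "subring S matrix_ring"
  shows "0 \<in> S"
    and "\<And>A B. A \<in> S \<Longrightarrow> B \<in> S \<Longrightarrow> A + B \<in> S"
    and "\<And>A B. A \<in> S \<Longrightarrow> B \<in> S \<Longrightarrow> A ** B \<in> S"
  using subringE(2,6,7)[OF assms] by (auto simp: matrix_ring_def)

section \<open>Fractional ideals\<close>

definition val_ge :: "('k::field \<Rightarrow> int) \<Rightarrow> int \<Rightarrow> 'k set" where
  "val_ge v m = {x. x = 0 \<or> m \<le> v x}"

context nonarch_local_field
begin

lemma v_one [simp]: "v 1 = 0"
  using v_mult[of 1 1] by simp

lemma v_uminus [simp]: "v (- x) = v x"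
proof (cases "x = 0")
  case False
  have "v (- 1) = 0" using v_mult[of "- 1" "- 1"] by simp
  with False show ?thesis using v_mult[of "- 1" x] by simp
qed simp

lemma v_divide: "x \<noteq> 0 \<Longrightarrow> y \<noteq> 0 \<Longrightarrow> v (x / y) = v x - v y"
  using v_mult[of "x / y" y] by simp

lemma v_power: "x \<noteq> 0 \<Longrightarrow> v (x ^ n) = int n * v x"
  by (induction n) (auto simp: v_mult algebra_simps)

lemma v_inverse: "x \<noteq> 0 \<Longrightarrow> v (inverse x) = - v x"
  using v_mult[of "inverse x" x] by simp

lemma v_powi: "x \<noteq> 0 \<Longrightarrow> v (x powi m) = m * v x"
  by (auto simp: power_int_def v_power v_inverse)

lemma obtain_val: obtains x where "x \<noteq> 0" "v x = m"
proof -
  have "m \<in> v ` {x. x \<noteq> 0}" using v_surj by simp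
  then show ?thesis using that by blast
qed

lemma val_ring_eq: "val_ring v = val_ge v 0"
  by (simp add: val_ring_def val_ge_def)

lemma val_ge_zero [simp]: "0 \<in> val_ge v m"
  by (simp add: val_ge_def)

lemma val_ge_add: "x \<in> val_ge v m \<Longrightarrow> y \<in> val_ge v m \<Longrightarrow> x + y \<in> val_ge v m"
  using v_add[of x y] by (cases "x = 0 \<or> y = 0 \<or> x + y = 0") (auto simp: val_ge_def)

lemma val_ge_sum: "(\<And>i. i \<in> I \<Longrightarrow> f i \<in> val_ge v m) \<Longrightarrow> sum f I \<in> val_ge v m"
  by (induction I rule: infinite_finite_induct) (auto intro: val_ge_add)

lemma val_ge_uminus: "x \<in> val_ge v m \<Longrightarrow> - x \<in> val_ge v m"
  by (auto simp: val_ge_def)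

lemma val_ge_mult: "x \<in> val_ge v m \<Longrightarrow> y \<in> val_ge v n \<Longrightarrow> x * y \<in> val_ge v (m + n)"
  using v_mult[of x y] by (cases "x = 0 \<or> y = 0") (auto simp: val_ge_def)

lemma val_ge_subset_iff: "val_ge v m \<subseteq> val_ge v n \<longleftrightarrow> n \<le> m"
proof
  assume "val_ge v m \<subseteq> val_ge v n"
  moreover obtain x where "x \<noteq> 0" "v x = m" by (rule obtain_val)
  ultimately show "n \<le> m" by (auto simp: val_ge_def)
qed (auto simp: val_ge_def)

lemma finite_subset_val_ge:
  assumes "finite X"
  obtains N where "X \<subseteq> val_ge v N"
proof
  \<comment> \<open>If \<open>0 \<in> X\<close>, the unspecified \<open>v 0\<close> enters the
    minimum but can only lower it. For empty \<open>X\<close> the minimum is an unspecified integer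
    and the inclusion is trivial.\<close>
  show "X \<subseteq> val_ge v (Min (v ` X))" using assms by (auto simp: val_ge_def)
qed

text \<open>The valuation is discrete, so \<open>I\<close> has a nonzero element of least valuation
  \<open>m\<close>; every element of \<open>val_ge v m\<close> is an \<O>-multiple of it.\<close>

lemma bounded_submodule_eq_val_ge:
  assumes I: "\<And>c x. c \<in> val_ring v \<Longrightarrow> x \<in> I \<Longrightarrow> c * x \<in> I"
    and bounded: "I \<subseteq> val_ge v N" and y: "y \<in> I" "y \<noteq> 0"
  shows "\<exists>m. I = val_ge v m"
proof -
  \<comment> \<open>Values are measured from the bound \<open>N\<close>, which turns the minimum
    over integers into a \<open>LEAST\<close> over natural numbers.\<close>
  define P where "P n \<longleftrightarrow> (\<exists>x\<in>I. x \<noteq> 0 \<and> v x = N + int n)" for n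
  have "N \<le> v y" using bounded y by (auto simp: val_ge_def)
  then have "P (nat (v y - N))" using y by (auto simp: P_def)
  then have least: "P (LEAST n. P n)" and le: "\<And>n. P n \<Longrightarrow> (LEAST n. P n) \<le> n"
    by (auto intro: LeastI Least_le)
  define m where "m = N + int (LEAST n. P n)"
  obtain x where x: "x \<in> I" "x \<noteq> 0" "v x = m" using least by (auto simp: P_def m_def)
  have "I \<subseteq> val_ge v m"
  proof
    fix z assume z: "z \<in> I"
    show "z \<in> val_ge v m"
    proof (cases "z = 0")
      case False
      with bounded z have "N \<le> v z" by (auto simp: val_ge_def)
      then have "P (nat (v z - N))" using z False by (auto simp: P_def)
      from le[OF this] \<open>N \<le> v z\<close> have "m \<le> v z" unfolding m_def by linarith
      then show ?thesis by (simp add: val_ge_def)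
    qed simp
  qed
  moreover have "z \<in> I" if "z \<in> val_ge v m" for z
  proof -
    have "z / x \<in> val_ring v" using that x
      by (cases "z = 0") (auto simp: val_ge_def val_ring_def v_divide)
    from I[OF this x(1)] x(2) show ?thesis by simp
  qed
  ultimately show ?thesis by blast
qed

text \<open>An element of valuation 1 is in the maximal ideal, hence a multiple of \<pi> by an
  element of \<O>, so \<open>v \<pi> \<le> 1\<close>; membership of \<pi> in that ideal gives
  \<open>0 < v \<pi>\<close>.\<close>

lemma uniformizer:
  assumes "max_ideal v = (\<lambda>a. \<pi> * a) ` val_ring v"
  shows "\<pi> \<noteq> 0" "v \<pi> = 1"
proof -
  obtain t where t: "t \<noteq> 0" "v t = 1" by (rule obtain_val)
  then have "t \<in> max_ideal v" by (simp add: max_ideal_def)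
  then obtain a where a: "t = \<pi> * a" "a \<in> val_ring v" using assms by blast
  with t show "\<pi> \<noteq> 0" by auto
  have "\<pi> * 1 \<in> max_ideal v" unfolding assms by (rule imageI) (simp add: val_ring_def)
  with \<open>\<pi> \<noteq> 0\<close> have "0 < v \<pi>" by (simp add: max_ideal_def)
  moreover have "a \<noteq> 0" using a t by auto
  then have "1 = v \<pi> + v a" "0 \<le> v a" using a t v_mult[OF \<open>\<pi> \<noteq> 0\<close>, of a]
    by (auto simp: val_ring_def)
  ultimately show "v \<pi> = 1" by linarith
qed

lemma frac_ideal_eq_val_ge:
  assumes "\<pi> \<noteq> 0" "v \<pi> = 1"
  shows "frac_ideal v \<pi> m = val_ge v m"
proof -
  have nz: "\<pi> powi m \<noteq> 0" and v: "v (\<pi> powi m) = m" using assms by (auto simp: v_powi)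
  have "x \<in> (\<lambda>a. \<pi> powi m * a) ` val_ring v" if "x \<in> val_ge v m" for x
  proof (rule image_eqI)
    show "x = \<pi> powi m * (x / \<pi> powi m)" using nz by simp
    show "x / \<pi> powi m \<in> val_ring v" using that nz v
      by (cases "x = 0") (auto simp: val_ge_def val_ring_def v_divide)
  qed
  moreover have "\<pi> powi m * a \<in> val_ge v m" if "a \<in> val_ring v" for a
    using that nz v by (cases "a = 0") (auto simp: val_ge_def val_ring_def v_mult)
  ultimately show ?thesis by (auto simp: frac_ideal_def)
qed

lemma frac_ideal_uniformizer:
  assumes "max_ideal v = (\<lambda>a. \<pi> * a) ` val_ring v"
  shows "frac_ideal v \<pi> m = val_ge v m"
  using frac_ideal_eq_val_ge uniformizer[OF assms] by blast

end

section \<open>Tiled orders\<close>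

text \<open>The common parameter set of the two sides: both the orders containing the diagonal and
  the reduced polytopes are images of it.\<close>

definition tiled :: "int ^ 'n ^ 'n \<Rightarrow> bool" where
  "tiled \<nu> \<longleftrightarrow> (\<forall>i. \<nu> $ i $ i = 0) \<and> (\<forall>i j k. \<nu> $ i $ k \<le> \<nu> $ i $ j + \<nu> $ j $ k)"

definition val_matrices :: "('k::field \<Rightarrow> int) \<Rightarrow> int ^ 'n ^ 'n \<Rightarrow> ('k ^ 'n ^ 'n) set" where
  "val_matrices v \<nu> = {A. \<forall>i j. A $ i $ j \<in> val_ge v (\<nu> $ i $ j)}"

context nonarch_local_field
begin

lemma elem_matrix_in_val_matrices:
  "elem_matrix i j c \<in> val_matrices v \<nu> \<longleftrightarrow> c \<in> val_ge v (\<nu> $ i $ j)"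
  by (auto simp: val_matrices_def)

text \<open>Elementary matrices test each entry separately, which reduces the claim to inclusions of
  fractional ideals. Uniqueness of the exponent matrix follows by antisymmetry.\<close>

lemma val_matrices_subset_iff:
  fixes \<mu> \<nu> :: "int ^ 'n::finite ^ 'n"
  shows "val_matrices v \<mu> \<subseteq> val_matrices v \<nu> \<longleftrightarrow> (\<forall>i j. \<nu> $ i $ j \<le> \<mu> $ i $ j)"
proof
  assume sub: "val_matrices v \<mu> \<subseteq> val_matrices v \<nu>"
  have "val_ge v (\<mu> $ i $ j) \<subseteq> val_ge v (\<nu> $ i $ j)" for i j
    using sub elem_matrix_in_val_matrices by blast
  then show "\<forall>i j. \<nu> $ i $ j \<le> \<mu> $ i $ j" by (simp add: val_ge_subset_iff)
next
  assume "\<forall>i j. \<nu> $ i $ j \<le> \<mu> $ i $ j"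
  then have "val_ge v (\<mu> $ i $ j) \<subseteq> val_ge v (\<nu> $ i $ j)" for i j
    by (simp add: val_ge_subset_iff)
  then show "val_matrices v \<mu> \<subseteq> val_matrices v \<nu>" by (fastforce simp: val_matrices_def)
qed

lemma val_matrices_inject:
  fixes \<mu> \<nu> :: "int ^ 'n::finite ^ 'n"
  shows "val_matrices v \<mu> = val_matrices v \<nu> \<longleftrightarrow> \<mu> = \<nu>"
  using val_matrices_subset_iff[of \<mu> \<nu>] val_matrices_subset_iff[of \<nu> \<mu>]
  by (auto simp: vec_eq_iff intro: antisym)

text \<open>A basis consists of the elementary matrices whose entry at \<open>(i, j)\<close> has
  valuation exactly \<open>\<nu> $ i $ j\<close>, a generator of the fractional ideal at that
  place.\<close>

lemma free_val_matrices:
  fixes \<nu> :: "int ^ 'n::finite ^ 'n"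
  shows "free_module_of_rank (val_ring v) (CARD('n)^2) (val_matrices v \<nu>)"
proof -
  define d where "d i j = (SOME x. x \<noteq> 0 \<and> v x = \<nu> $ i $ j)" for i j
  have d: "d i j \<noteq> 0 \<and> v (d i j) = \<nu> $ i $ j" for i j
    unfolding d_def by (rule someI_ex) (meson obtain_val)
  then have nz: "\<And>i j. d i j \<noteq> 0" by blast
  note nth = sum_elem_basis_nth[of d, OF nz]
  have "\<exists>c. (\<forall>b\<in>elem_basis d. c b \<in> val_ring v) \<and>
      A = (\<Sum>b\<in>elem_basis d. smult_matrix (c b) b)" if A: "A \<in> val_matrices v \<nu>" for A
  proof -
    \<comment> \<open>Coefficients are functions of the basis element, so \<open>g\<close> recovers
      the place \<open>(i, j)\<close> from the matrix.\<close>
    define g where "g = inv_into UNIV (\<lambda>(i, j). elem_matrix i j (d i j))"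
    have g: "g (elem_matrix i j (d i j)) = (i, j)" for i j
      using inv_f_f[OF inj_elem_matrix[of d, OF nz], of "(i, j)"] by (simp add: g_def)
    define c where "c b = (case g b of (i, j) \<Rightarrow> A $ i $ j / d i j)" for b
    have c: "c (elem_matrix i j (d i j)) = A $ i $ j / d i j" for i j by (simp add: c_def g)
    have "A $ i $ j / d i j \<in> val_ring v" for i j
      using A d[of i j] by (cases "A $ i $ j = 0")
        (auto simp: val_matrices_def val_ge_def val_ring_def v_divide)
    then have "\<forall>b\<in>elem_basis d. c b \<in> val_ring v" by (auto simp: elem_basis_def c)
    moreover have "A = (\<Sum>b\<in>elem_basis d. smult_matrix (c b) b)"
      unfolding vec_eq_iff nth using nz by (simp add: c)
    ultimately show ?thesis by blast
  qed
  moreover have "(\<Sum>b\<in>elem_basis d. smult_matrix (c b) b) \<in> val_matrices v \<nu>"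
    if c: "\<forall>b\<in>elem_basis d. c b \<in> val_ring v" for c
  proof -
    have "c (elem_matrix i j (d i j)) * d i j \<in> val_ge v (0 + \<nu> $ i $ j)" for i j
      by (rule val_ge_mult) (use c d in \<open>auto simp: elem_basis_def val_ring_eq val_ge_def\<close>)
    then show ?thesis unfolding val_matrices_def mem_Collect_eq nth by simp
  qed
  moreover have "c b = 0"
    if "(\<Sum>b\<in>elem_basis d. smult_matrix (c b) b) = 0" "b \<in> elem_basis d" for c b
  proof -
    have "c (elem_matrix i j (d i j)) * d i j = 0" for i j
      using that(1) nth[of c i j] by simp
    with that(2) nz show ?thesis by (auto simp: elem_basis_def)
  qed
  ultimately show ?thesis unfolding free_module_of_rank_def
    using card_elem_basis[of d, OF nz] finite_elem_basis[of d] by (intro exI[of _ "elem_basis d"]) blast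
qed

text \<open>The triangle inequality puts each term of an entry of a product into the required ideal;
  the zero diagonal admits the identity matrix.\<close>

lemma subring_val_matrices:
  fixes \<nu> :: "int ^ 'n::finite ^ 'n"
  assumes "tiled \<nu>"
  shows "subring (val_matrices v \<nu>) matrix_ring"
proof (rule ring.subringI[OF ring_matrix_ring])
  fix A B assume A: "A \<in> val_matrices v \<nu>" and B: "B \<in> val_matrices v \<nu>"
  have "A $ i $ k * B $ k $ j \<in> val_ge v (\<nu> $ i $ j)" for i j k
  proof -
    have "A $ i $ k * B $ k $ j \<in> val_ge v (\<nu> $ i $ k + \<nu> $ k $ j)"
      using A B by (intro val_ge_mult) (auto simp: val_matrices_def)
    then show ?thesis using assms val_ge_subset_iff unfolding tiled_def by blast
  qed
  then have "A ** B \<in> val_matrices v \<nu>"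
    by (auto simp: val_matrices_def matrix_matrix_mult_def intro: val_ge_sum)
  then show "A \<otimes>\<^bsub>matrix_ring\<^esub> B \<in> val_matrices v \<nu>" by (simp add: matrix_ring_def)
  show "A \<oplus>\<^bsub>matrix_ring\<^esub> B \<in> val_matrices v \<nu>"
    using A B by (auto simp: val_matrices_def matrix_ring_def val_ge_add)
next
  fix A assume "A \<in> val_matrices v \<nu>"
  then show "\<ominus>\<^bsub>matrix_ring\<^esub> A \<in> val_matrices v \<nu>"
    by (auto simp: val_matrices_def a_inv_matrix_ring val_ge_uminus)
next
  show "\<one>\<^bsub>matrix_ring\<^esub> \<in> val_matrices v \<nu>"
    using assms by (auto simp: val_matrices_def matrix_ring_def mat_def tiled_def val_ge_def)
qed (simp add: matrix_ring_def)

lemma val_matrices_in_orders: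
  assumes "tiled \<nu>"
  shows "val_matrices v \<nu> \<in> orders_containing_diag v"
proof -
  have "diag_order v \<subseteq> val_matrices v \<nu>"
    using assms by (auto simp: diag_order_def val_matrices_def tiled_def val_ring_eq)
  then show ?thesis
    by (simp add: orders_containing_diag_def is_order_def free_val_matrices
        subring_val_matrices[OF assms])
qed

section \<open>Structure of the orders that contain the diagonal order\<close>

text \<open>The finitely many generators have entries of bounded valuation at \<open>(i, j)\<close>,
  and coefficients from \<O> do not break the bound.\<close>

lemma free_module_entries_bounded:
  fixes S :: "('k ^ 'n::finite ^ 'n) set"
  assumes "free_module_of_rank (val_ring v) r S"
  obtains N where "\<And>A. A \<in> S \<Longrightarrow> A $ i $ j \<in> val_ge v N"
proof -
  obtain B where B: "finite B"
      "S = {\<Sum>b\<in>B. smult_matrix (c b) b | c. \<forall>b\<in>B. c b \<in> val_ring v}"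
    using assms unfolding free_module_of_rank_def by blast
  obtain N where N: "(\<lambda>b. b $ i $ j) ` B \<subseteq> val_ge v N"
    using finite_subset_val_ge[of "(\<lambda>b. b $ i $ j) ` B"] B(1) by blast
  have "A $ i $ j \<in> val_ge v N" if "A \<in> S" for A
  proof -
    from \<open>A \<in> S\<close> obtain c where A: "A = (\<Sum>b\<in>B. smult_matrix (c b) b)" and c: "\<forall>b\<in>B. c b \<in> val_ring v"
      unfolding B(2) by blast
    have "c b * b $ i $ j \<in> val_ge v (0 + N)" if "b \<in> B" for b
      by (rule val_ge_mult) (use that c N in \<open>auto simp: val_ring_eq\<close>)
    then show ?thesis unfolding A by (auto intro: val_ge_sum)
  qed
  then show ?thesis by (rule that)
qed

text \<open>Clearing denominators turns independence over \<O> into independence over the field. An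
  \<O>-basis of \<open>S\<close> is then a basis of the full matrix space, and one of its members is
  nonzero at \<open>(i, j)\<close>.\<close>

lemma full_rank_nth_nonzero:
  fixes S :: "('k ^ 'n::finite ^ 'n) set"
  assumes "free_module_of_rank (val_ring v) (CARD('n)^2) S"
  shows "\<exists>A\<in>S. A $ i $ j \<noteq> 0"
proof -
  obtain B where B: "finite B" "card B = CARD('n)^2"
      "S = {\<Sum>b\<in>B. smult_matrix (c b) b | c. \<forall>b\<in>B. c b \<in> val_ring v}"
    and indep: "\<And>c. \<forall>b\<in>B. c b \<in> val_ring v \<Longrightarrow> (\<Sum>b\<in>B. smult_matrix (c b) b) = 0 \<Longrightarrow>
      \<forall>b\<in>B. c b = 0"
    using assms unfolding free_module_of_rank_def by blast
  have "c b = 0" if c: "(\<Sum>b\<in>B. smult_matrix (c b) b) = 0" and b: "b \<in> B" for c b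
  proof -
    obtain N where N: "c ` B \<subseteq> val_ge v N"
      using finite_subset_val_ge[OF finite_imageI[OF B(1)]] .
    \<comment> \<open>A common denominator: multiplication by \<open>d\<close> moves all
      coefficients \<open>c b\<close> into \<O>.\<close>
    obtain d where d: "d \<noteq> 0" "v d = - N" by (rule obtain_val)
    have "d * c b \<in> val_ge v (- N + N)" if "b \<in> B" for b
    proof (rule val_ge_mult)
      show "d \<in> val_ge v (- N)" by (simp add: val_ge_def d(2))
      show "c b \<in> val_ge v N" using N that by blast
    qed
    moreover have "(\<Sum>b\<in>B. smult_matrix (d * c b) b) = smult_matrix d (\<Sum>b\<in>B. smult_matrix (c b) b)"
      by (simp add: matrix_space.scale_sum_right)
    ultimately have "\<forall>b\<in>B. d * c b = 0" by (intro indep) (auto simp: c val_ring_eq)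
    with b d show ?thesis by simp
  qed
  then have "matrix_space.independent B"
    unfolding matrix_space.dependent_finite[OF B(1)] by blast
  from matrix_space_independent_nth_nonzero[OF this B(2)]
  obtain b where b: "b \<in> B" "b $ i $ j \<noteq> 0" by blast
  have "(\<Sum>a\<in>B. smult_matrix (if a = b then 1 else 0) a) = (\<Sum>a\<in>B. if a = b then b else 0)"
    by (rule sum.cong) auto
  then have "b = (\<Sum>a\<in>B. smult_matrix (if a = b then 1 else 0) a)"
    using b(1) B(1) by simp
  moreover have "\<forall>a\<in>B. (if a = b then 1 else 0) \<in> val_ring v" by (simp add: val_ring_def)
  ultimately have "b \<in> S"
    unfolding B(3) mem_Collect_eq by (intro exI[of _ "\<lambda>a. if a = b then 1 else 0"] conjI)
  with b(2) show ?thesis by blast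
qed

lemma diag_elem_matrix: "c \<in> val_ring v \<Longrightarrow> elem_matrix i i c \<in> diag_order v"
  unfolding diag_order_def mem_Collect_eq
  by (intro exI[of _ "\<lambda>a. if a = i then c else 0"])
    (auto simp: vec_eq_iff val_ring_def)

lemma order_eq_val_matrices:
  fixes S :: "('k ^ 'n::finite ^ 'n) set"
  assumes "S \<in> orders_containing_diag v"
  obtains \<nu> where "tiled \<nu>" "S = val_matrices v \<nu>"
proof -
  have sub: "subring S matrix_ring"
    and free: "free_module_of_rank (val_ring v) (CARD('n)^2) S"
    and diag: "diag_order v \<subseteq> S"
    using assms by (auto simp: orders_containing_diag_def is_order_def)
  note S = subring_matrix_ringD[OF sub]
  have one: "1 \<in> val_ring v" by (simp add: val_ring_def)
  have scaled: "elem_matrix i j (c * A $ i $ j) \<in> S" if "A \<in> S" "c \<in> val_ring v" for A c i j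
    unfolding elem_matrix_sandwich[symmetric]
    using that one diag by (intro S(3)) (auto intro: diag_elem_matrix)
  have entry: "elem_matrix i j (A $ i $ j) \<in> S" if "A \<in> S" for A i j
    using scaled[OF that one] by simp
  \<comment> \<open>By \<open>entry\<close>, this is also the set of all values that members of
    \<open>S\<close> take at \<open>(i, j)\<close>.\<close>
  define I where "I i j = {x. elem_matrix i j x \<in> S}" for i j
  have "\<exists>m. I i j = val_ge v m" for i j
  proof -
    obtain N where N: "\<And>A. A \<in> S \<Longrightarrow> A $ i $ j \<in> val_ge v N"
      using free_module_entries_bounded[OF free] by blast
    obtain A where A: "A \<in> S" "A $ i $ j \<noteq> 0" using full_rank_nth_nonzero[OF free] by blast
    show ?thesis
    proof (rule bounded_submodule_eq_val_ge)
      show "c * x \<in> I i j" if "c \<in> val_ring v" "x \<in> I i j" for c x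
        using scaled[of "elem_matrix i j x" c i j] that by (simp add: I_def)
      show "I i j \<subseteq> val_ge v N" using N[of "elem_matrix i j _"] by (auto simp: I_def)
      show "A $ i $ j \<in> I i j" using entry[OF A(1)] by (simp add: I_def)
    qed (rule A)
  qed
  then obtain m where m: "\<And>i j. I i j = val_ge v (m i j)" by metis
  define \<nu> :: "int ^ 'n ^ 'n" where "\<nu> = (\<chi> i j. m i j)"
  have elem: "elem_matrix i j x \<in> S \<longleftrightarrow> x \<in> val_ge v (\<nu> $ i $ j)" for i j x
    using m[of i j] by (auto simp: I_def \<nu>_def)
  have S_eq: "S = val_matrices v \<nu>"
  proof
    show "S \<subseteq> val_matrices v \<nu>" using entry elem by (auto simp: val_matrices_def)
    \<comment> \<open>A matrix is the sum of its elementary pieces, each of which lies in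
      \<open>S\<close>. An arbitrary index set \<open>P\<close> makes the induction
      possible.\<close>
    have "(\<Sum>(i, j)\<in>P. elem_matrix i j (A $ i $ j)) \<in> S"
      if "A \<in> val_matrices v \<nu>" for A and P :: "('n \<times> 'n) set"
      by (induction P rule: infinite_finite_induct)
        (use that in \<open>auto simp: val_matrices_def elem intro!: S\<close>)
    from this[of _ UNIV] show "val_matrices v \<nu> \<subseteq> S"
      by (auto simp only: matrix_eq_sum_elem[symmetric])
  qed
  \<comment> \<open>Entries of exactly the least valuation are multiplied; closure under products
    then forces the inequality.\<close>
  have triangle: "\<nu> $ i $ k \<le> \<nu> $ i $ j + \<nu> $ j $ k" for i j k
  proof -
    obtain x y where x: "x \<noteq> 0" "v x = \<nu> $ i $ j" and y: "y \<noteq> 0" "v y = \<nu> $ j $ k"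
      by (meson obtain_val)
    have "elem_matrix i j x ** elem_matrix j k y \<in> S"
      using x y by (intro S(3)) (auto simp: elem val_ge_def)
    then show ?thesis
      using x y v_mult[of x y] by (simp add: elem_matrix_mult_elem_matrix elem val_ge_def)
  qed
  \<comment> \<open>The diagonal idempotent in \<open>S\<close> gives the upper bound 0, and the
    triangle inequality at \<open>i, i, i\<close> gives the lower one.\<close>
  have "\<nu> $ i $ i = 0" for i
  proof -
    have "elem_matrix i i 1 \<in> S" using diag one diag_elem_matrix by blast
    then have "\<nu> $ i $ i \<le> 0" by (simp add: elem val_ge_def)
    with triangle[of i i i] show ?thesis by simp
  qed
  with triangle have "tiled \<nu>" by (simp add: tiled_def)
  then show ?thesis using S_eq by (rule that)
qed

lemma orders_containing_diag_eq: "orders_containing_diag v = val_matrices v ` {\<nu>. tiled \<nu>}"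
  by (auto intro: val_matrices_in_orders elim: order_eq_val_matrices)

end

section \<open>Reduced polytopes\<close>

text \<open>The lower bound for \<open>(i, j)\<close> is the upper bound for \<open>(j, i)\<close>,
  so one family of inequalities suffices.\<close>

lemma poly_C_iff:
  "x \<in> poly_C o1 \<nu> \<longleftrightarrow> x $ o1 = 0 \<and> (\<forall>i j. x $ i - x $ j \<le> real_of_int (\<nu> $ i $ j))"
proof
  assume x: "x $ o1 = 0 \<and> (\<forall>i j. x $ i - x $ j \<le> real_of_int (\<nu> $ i $ j))"
  have "- real_of_int (\<nu> $ j $ i) \<le> x $ i - x $ j" for i j
    using x[THEN conjunct2, rule_format, of j i] by linarith
  with x show "x \<in> poly_C o1 \<nu>" by (simp add: poly_C_def)
qed (simp add: poly_C_def)

lemma lattice_points_poly_C: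
  "m \<in> lattice_points o1 (poly_C o1 \<nu>) \<longleftrightarrow> m $ o1 = 0 \<and> (\<forall>i j. m $ i - m $ j \<le> \<nu> $ i $ j)"
  unfolding lattice_points_def poly_C_iff by (simp flip: of_int_diff)

lemma tiled_vertex:
  assumes "tiled \<nu>"
  obtains m where "m \<in> lattice_points o1 (poly_C o1 \<nu>)" "m $ i - m $ j = \<nu> $ i $ j"
proof
  \<comment> \<open>Column \<open>j\<close> of \<nu>, shifted to vanish at \<open>o1\<close>. Its
    bounds are triangle inequalities through \<open>j\<close>, and the equality at
    \<open>(i, j)\<close> holds because \<open>\<nu> $ j $ j = 0\<close>.\<close>
  let ?m = "\<chi> a. \<nu> $ a $ j - \<nu> $ o1 $ j"
  have "\<nu> $ a $ j - \<nu> $ b $ j \<le> \<nu> $ a $ b" for a b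
    using assms unfolding tiled_def by (simp add: diff_le_eq)
  then show "?m \<in> lattice_points o1 (poly_C o1 \<nu>)" by (simp add: lattice_points_poly_C)
  show "?m $ i - ?m $ j = \<nu> $ i $ j" using assms by (simp add: tiled_def)
qed

lemma reduced_iff_tiled: "reduced o1 \<nu> \<longleftrightarrow> tiled \<nu>"
proof
  assume red: "reduced o1 \<nu>"
  have ex: "\<exists>x\<in>poly_C o1 \<nu>. x $ i - x $ j = real_of_int (\<nu> $ i $ j)" for i j
    using red unfolding reduced_def by blast
  have "\<nu> $ i $ k \<le> \<nu> $ i $ j + \<nu> $ j $ k" for i j k
  proof -
    \<comment> \<open>At a point where the bound for \<open>(i, k)\<close> is attained, the
      difference splits at \<open>j\<close> into two differences bounded by \<nu>.\<close>
    obtain x where x: "x \<in> poly_C o1 \<nu>" "x $ i - x $ k = real_of_int (\<nu> $ i $ k)"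
      using ex by blast
    then have "x $ i - x $ j \<le> real_of_int (\<nu> $ i $ j)" "x $ j - x $ k \<le> real_of_int (\<nu> $ j $ k)"
      by (auto simp: poly_C_iff)
    with x(2) show ?thesis by linarith
  qed
  moreover have "\<nu> $ i $ i = 0" for i using ex[of i i] by simp
  ultimately show "tiled \<nu>" by (simp add: tiled_def)
next
  assume t: "tiled \<nu>"
  have "{x. x $ i - x $ j = real_of_int (\<nu> $ i $ j)} \<inter> poly_C o1 \<nu> \<noteq> {}" for i j
  proof -
    obtain m where m: "m \<in> lattice_points o1 (poly_C o1 \<nu>)" "m $ i - m $ j = \<nu> $ i $ j"
      using tiled_vertex[OF t] .
    then have "(\<chi> a. real_of_int (m $ a)) \<in> {x. x $ i - x $ j = real_of_int (\<nu> $ i $ j)} \<inter> poly_C o1 \<nu>"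
      by (simp add: lattice_points_def flip: of_int_diff)
    then show ?thesis by blast
  qed
  moreover have "lattice_points o1 (poly_C o1 \<nu>) \<noteq> {}" using tiled_vertex[OF t] by blast
  ultimately show "reduced o1 \<nu>" by (simp add: reduced_def)
qed

lemma reduced_polytopes_eq: "reduced_polytopes o1 = poly_C o1 ` {\<nu>. tiled \<nu>}"
  by (auto simp: reduced_polytopes_def reduced_iff_tiled)

section \<open>The two maps between orders and polytopes\<close>

context nonarch_local_field
begin

context
  fixes \<pi> assumes generator: "max_ideal v = (\<lambda>a. \<pi> * a) ` val_ring v"
begin

lemma ideal_matrices_eq: "ideal_matrices v \<pi> \<nu> = val_matrices v \<nu>"
  by (simp add: ideal_matrices_def val_matrices_def frac_ideal_uniformizer[OF generator])

text \<open>Injectivity of \<open>val_matrices v\<close> makes the definite description in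
  \<open>exponent_matrix\<close> return \<nu>.\<close>

lemma polytope_of_val_matrices:
  fixes \<nu> :: "int ^ 'n::finite ^ 'n"
  assumes "tiled \<nu>"
  shows "polytope_of_order v \<pi> o1 (val_matrices v \<nu>) = poly_C o1 \<nu>"
proof -
  have "exponent_matrix v \<pi> (val_matrices v \<nu>) = \<nu>"
    unfolding exponent_matrix_def ideal_matrices_eq val_matrices_inject
    using assms by (intro the_equality) (auto simp: tiled_def)
  then show ?thesis by (simp add: polytope_of_order_def)
qed

text \<open>For each place \<open>(i, j)\<close> some lattice point attains
  \<open>m $ i - m $ j = \<nu> $ i $ j\<close>, so the intersection is small enough there.
  Conversely \<open>m $ i - m $ j \<le> \<nu> $ i $ j\<close> at every lattice point, and ideals
  shrink as exponents grow.\<close>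

lemma order_of_poly_C:
  fixes \<nu> :: "int ^ 'n::finite ^ 'n"
  assumes "tiled \<nu>"
  shows "order_of_polytope v \<pi> o1 (poly_C o1 \<nu>) = val_matrices v \<nu>"
proof
  have "A $ i $ j \<in> val_ge v (\<nu> $ i $ j)" if A: "A \<in> order_of_polytope v \<pi> o1 (poly_C o1 \<nu>)" for A i j
  proof -
    obtain m where m: "m \<in> lattice_points o1 (poly_C o1 \<nu>)" "m $ i - m $ j = \<nu> $ i $ j"
      using tiled_vertex[OF assms] .
    from A m(1) have "A \<in> maximal_order v \<pi> m" by (simp add: order_of_polytope_def)
    then have "A $ i $ j \<in> val_ge v (m $ i - m $ j)"
      by (simp add: maximal_order_def frac_ideal_uniformizer[OF generator])
    then show ?thesis by (simp add: m(2))
  qed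
  then show "order_of_polytope v \<pi> o1 (poly_C o1 \<nu>) \<subseteq> val_matrices v \<nu>"
    by (auto simp: val_matrices_def)
  have "A \<in> maximal_order v \<pi> m"
    if "A \<in> val_matrices v \<nu>" "m \<in> lattice_points o1 (poly_C o1 \<nu>)" for A m
  proof -
    from that(2) have "val_ge v (\<nu> $ i $ j) \<subseteq> val_ge v (m $ i - m $ j)" for i j
      by (simp add: val_ge_subset_iff lattice_points_poly_C)
    with that(1) show ?thesis
      unfolding maximal_order_def frac_ideal_uniformizer[OF generator] val_matrices_def by blast
  qed
  then show "val_matrices v \<nu> \<subseteq> order_of_polytope v \<pi> o1 (poly_C o1 \<nu>)"
    by (auto simp: order_of_polytope_def)
qed

end

end

theorem theorem3p8:
  fixes v :: "'k::field \<Rightarrow> int" and \<pi> :: 'k and o1 :: "'n::finite"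
  assumes "nonarch_local_field v"
    and "max_ideal v = (\<lambda>a. \<pi> * a) ` val_ring v"
  shows "(\<forall>S :: ('k ^ 'n ^ 'n) set. is_order v S \<and> diag_order v \<subseteq> S \<longrightarrow>
            (\<exists>!\<nu> :: int ^ 'n ^ 'n. (\<forall>i. \<nu> $ i $ i = 0) \<and> S = ideal_matrices v \<pi> \<nu>)) \<and>
         bij_betw (polytope_of_order v \<pi> o1) (orders_containing_diag v) (reduced_polytopes o1) \<and>
         bij_betw (order_of_polytope v \<pi> o1) (reduced_polytopes o1) (orders_containing_diag v) \<and>
         (\<forall>S \<in> orders_containing_diag v.
            order_of_polytope v \<pi> o1 (polytope_of_order v \<pi> o1 S) = S) \<and>
         (\<forall>C \<in> reduced_polytopes o1.
            polytope_of_order v \<pi> o1 (order_of_polytope v \<pi> o1 C) = C)"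
proof -
  interpret nonarch_local_field v by (rule assms)
  \<comment> \<open>With both sets written as images of the tiled matrices, each map sends the image
    of \<nu> on one side to its image on the other. Hence the maps are mutually inverse, which also
    gives both bijections.\<close>
  note defs = orders_containing_diag_eq reduced_polytopes_eq
    polytope_of_val_matrices[OF assms(2)] order_of_poly_C[OF assms(2)]
  have "\<exists>!\<nu> :: int ^ 'n ^ 'n. (\<forall>i. \<nu> $ i $ i = 0) \<and> S = ideal_matrices v \<pi> \<nu>"
    if "is_order v S \<and> diag_order v \<subseteq> S" for S :: "('k ^ 'n ^ 'n) set"
  proof -
    have "S \<in> orders_containing_diag v" using that by (simp add: orders_containing_diag_def)
    then obtain \<nu> where "tiled \<nu>" "S = val_matrices v \<nu>" by (rule order_eq_val_matrices)
    then show ?thesis unfolding ideal_matrices_eq[OF assms(2)]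
      by (intro ex1I[of _ \<nu>]) (auto simp: tiled_def val_matrices_inject)
  qed
  moreover have "bij_betw (polytope_of_order v \<pi> o1) (orders_containing_diag v) (reduced_polytopes o1)"
    by (rule bij_betw_byWitness[where f' = "order_of_polytope v \<pi> o1"]) (auto simp: defs)
  moreover have "bij_betw (order_of_polytope v \<pi> o1) (reduced_polytopes o1) (orders_containing_diag v)"
    by (rule bij_betw_byWitness[where f' = "polytope_of_order v \<pi> o1"]) (auto simp: defs)
  ultimately show ?thesis by (auto simp: defs)
qed

end
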